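(* Let $d\ge 4$ be even and $n\ge 3$. Every generic non-negative form $g\in\overline{\mathcal{C}_{d,n}}$ is in $\mathcal{V}_{d,n}$, i.e. the sublevel set $\{\mathbf{x}\in\mathbb{R}^n: g(\mathbf{x})\le 1\}$ has finite Lebesgue volume.
   Context: $\mathcal{H}_{d,n}$ is the space of real $n$-variate forms (homogeneous polynomials) of degree $d$; $\mathcal{C}_{d,n}\subset\mathcal{H}_{d,n}$ is the cone of forms strictly positive on $\mathbb{R}^n\setminus\{\mathbf{0}\}$, and its closure $\overline{\mathcal{C}_{d,n}}$ is the cone of forms non-negative on $\mathbb{R}^n$. $\mathcal{V}_{d,n}$ is the set of forms $g\in\mathcal{H}_{d,n}$ whose sublevel set $\{\mathbf{x}\in\mathbb{R}^n: g(\mathbf{x})\le 1\}$ has finite Lebesgue volume. A non-negative form $g\in\overline{\mathcal{C}_{d,n}}$ is called generic if at every real zero $\mathbf{x}\in\mathbb{R}^n\setminus\{\mathbf{0}\}$ of $g$ the Hessian matrix $\mathrm{Hess}_{\mathbf{x}}g=\left(\frac{\partial^2g}{\partial x_i\partial x_j}(\mathbf{x})\right)$ is positive definite when restricted to the orthogonal complement of $\mathbf{x}$ (equivalently, $\mathrm{Hess}_{\mathbf{x}}g$ is of corank one). *)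

theory Defs
  imports "HOL-Analysis.Analysis"
begin

text \<open>
  Real forms are represented by the polynomial functions they induce on \<open>\<real>\<^sup>n\<close>; since the
  reals are infinite, this identifies \<open>H d\<close> with the space of formal homogeneous polynomials.
  The number \<open>n\<close> of variables is \<open>CARD('n)\<close>, and monomials are given by exponent
  vectors \<open>\<alpha> :: 'n \<Rightarrow> nat\<close> with entry sum \<open>d\<close> (a finite set).
\<close>

definition forms :: "nat \<Rightarrow> (real ^ 'n \<Rightarrow> real) set" where
  "forms d = {g. \<exists>c :: ('n \<Rightarrow> nat) \<Rightarrow> real.
     g = (\<lambda>x. \<Sum>\<alpha> | sum \<alpha> UNIV = d. c \<alpha> * (\<Prod>i\<in>UNIV. (x $ i) ^ \<alpha> i))}"

definition positive_forms :: "nat \<Rightarrow> (real ^ 'n \<Rightarrow> real) set" where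
  "positive_forms d = {g \<in> forms d. \<forall>x. x \<noteq> 0 \<longrightarrow> g x > 0}"

text \<open>
  For even \<open>d > 0\<close> this is the closure of \<open>positive_forms d\<close> within \<open>forms d\<close>,
  see \<open>nonneg_forms_eq_closure\<close> below.
\<close>

definition nonneg_forms :: "nat \<Rightarrow> (real ^ 'n \<Rightarrow> real) set" where
  "nonneg_forms d = {g \<in> forms d. \<forall>x. g x \<ge> 0}"

definition finite_volume_forms :: "nat \<Rightarrow> (real ^ 'n \<Rightarrow> real) set" where
  "finite_volume_forms d = {g \<in> forms d. {x. g x \<le> 1} \<in> lmeasurable}"

definition partial_deriv :: "'n \<Rightarrow> (real ^ 'n \<Rightarrow> real) \<Rightarrow> real ^ 'n \<Rightarrow> real" where
  "partial_deriv i f x = deriv (\<lambda>t. f (x + t *\<^sub>R axis i 1)) 0"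

definition hessian :: "(real ^ 'n \<Rightarrow> real) \<Rightarrow> real ^ 'n \<Rightarrow> real ^ 'n ^ 'n" where
  "hessian f x = (\<chi> i j. partial_deriv i (partial_deriv j f) x)"

definition generic_form :: "(real ^ 'n \<Rightarrow> real) \<Rightarrow> bool" where
  "generic_form g \<longleftrightarrow>
     (\<forall>x. x \<noteq> 0 \<and> g x = 0 \<longrightarrow>
        (\<forall>v. v \<noteq> 0 \<and> orthogonal x v \<longrightarrow> v \<bullet> (hessian g x *v v) > 0))"

lemma forms_add:
  assumes "f \<in> forms d" "g \<in> forms d"
  shows "(\<lambda>x. f x + r * g x) \<in> forms d"
proof -
  obtain a b :: "('a \<Rightarrow> nat) \<Rightarrow> real"
    where "f = (\<lambda>x. \<Sum>\<alpha> | sum \<alpha> UNIV = d. a \<alpha> * (\<Prod>i\<in>UNIV. (x $ i) ^ \<alpha> i))"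
      and "g = (\<lambda>x. \<Sum>\<alpha> | sum \<alpha> UNIV = d. b \<alpha> * (\<Prod>i\<in>UNIV. (x $ i) ^ \<alpha> i))"
    using assms unfolding forms_def by auto
  then show ?thesis
    unfolding forms_def
    by (auto intro!: exI[of _ "\<lambda>\<alpha>. a \<alpha> + r * b \<alpha>"]
        simp: sum_distrib_left sum.distrib algebra_simps)
qed

lemma finite_exponents: "finite {\<alpha> :: 'n::finite \<Rightarrow> nat. sum \<alpha> UNIV = d}"
proof (rule finite_subset)
  show "{\<alpha> :: 'n \<Rightarrow> nat. sum \<alpha> UNIV = d} \<subseteq> Pi\<^sub>E UNIV (\<lambda>_. {..d})"
    by (auto intro: member_le_sum)
  show "finite (Pi\<^sub>E (UNIV :: 'n set) (\<lambda>_. {..d}))"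
    by (intro finite_PiE) auto
qed

lemma power_in_forms: "(\<lambda>x :: real ^ 'n. (x $ k) ^ d) \<in> forms d"
proof -
  define \<beta> :: "'n \<Rightarrow> nat" where "\<beta> = (\<lambda>i. if i = k then d else 0)"
  have mon: "(\<Prod>i\<in>UNIV. (x $ i) ^ \<beta> i) = (x $ k) ^ d" for x :: "real ^ 'n"
    by (subst prod.remove[of _ k]) (auto simp: \<beta>_def intro!: prod.neutral)
  have "(\<Sum>\<alpha> | sum \<alpha> UNIV = d. (if \<alpha> = \<beta> then 1 else 0) * (\<Prod>i\<in>UNIV. (x $ i) ^ \<alpha> i))
      = (x $ k) ^ d" for x :: "real ^ 'n"
  proof -
    have "sum \<beta> UNIV = d" by (simp add: \<beta>_def)
    then show ?thesis
      by (subst sum.remove[OF finite_exponents, of \<beta>]) (auto simp: mon intro!: sum.neutral)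
  qed
  then show ?thesis
    unfolding forms_def
    by (intro CollectI exI[of _ "\<lambda>\<alpha>. if \<alpha> = \<beta> then 1 else 0"]) auto
qed

lemma forms_zero: "(\<lambda>x. 0) \<in> forms d"
  unfolding forms_def by (auto intro!: exI[of _ "\<lambda>_. 0"])

lemma sum_powers_in_forms: "(\<lambda>x :: real ^ 'n. \<Sum>k\<in>A. (x $ k) ^ d) \<in> forms d"
proof (induction A rule: infinite_finite_induct)
  case (insert k A)
  show ?case
    using forms_add[OF power_in_forms insert.IH, of k 1] insert.hyps by simp
qed (auto simp: forms_zero)

text \<open>
  The topology on functions is that of pointwise convergence, which on the finite-dimensional
  space \<open>forms d\<close> is the usual one.
\<close>

lemma nonneg_forms_eq_closure:
  assumes "even d" "d > 0"
  shows "nonneg_forms d = forms d \<inter> closure (positive_forms d :: (real ^ 'n \<Rightarrow> real) set)"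
proof (intro equalityI subsetI)
  fix g :: "real ^ 'n \<Rightarrow> real" assume g: "g \<in> nonneg_forms d"
  define h where "h = (\<lambda>m x. g x + (1 / real (Suc m)) * (\<Sum>k\<in>UNIV. (x $ k) ^ d))"
  have pos: "h m \<in> positive_forms d" for m
  proof -
    have "0 < (\<Sum>k\<in>UNIV. (x $ k) ^ d)" if nz: "x \<noteq> 0" for x :: "real ^ 'n"
    proof -
      obtain k where "x $ k \<noteq> 0" using nz by (metis vec_eq_iff zero_index)
      then show ?thesis
        using assms by (intro sum_pos2[of _ k]) (auto simp: zero_le_even_power zero_less_power_eq)
    qed
    then show ?thesis
      using g forms_add[OF _ sum_powers_in_forms, of g d "1 / real (Suc m)" UNIV]
      by (auto simp: positive_forms_def nonneg_forms_def h_def intro!: add_nonneg_pos)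
  qed
  define F where "F = (\<lambda>(t::real) (x :: real ^ 'n). g x + t * (\<Sum>k\<in>UNIV. (x $ k) ^ d))"
  have "continuous_on UNIV F"
    unfolding F_def by (intro continuous_on_coordinatewise_then_product continuous_intros)
  then have "isCont F 0" by (simp add: continuous_on_eq_continuous_at)
  moreover have "(\<lambda>m. 1 / real (Suc m)) \<longlonglongrightarrow> 0"
    using LIMSEQ_inverse_real_of_nat by (simp add: inverse_eq_divide)
  ultimately have "(\<lambda>m. F (1 / real (Suc m))) \<longlonglongrightarrow> F 0"
    by (rule isCont_tendsto_compose)
  then have "h \<longlonglongrightarrow> g" by (simp add: F_def h_def)
  then have "g \<in> closure (positive_forms d)"
    using pos by (intro Lim_in_closed_set[OF closed_closure _ _ \<open>h \<longlonglongrightarrow> g\<close>])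
      (auto intro!: always_eventually closure_subset[THEN subsetD])
  with g show "g \<in> forms d \<inter> closure (positive_forms d)"
    by (simp add: nonneg_forms_def)
next
  fix g :: "real ^ 'n \<Rightarrow> real" assume g: "g \<in> forms d \<inter> closure (positive_forms d)"
  have "f x \<ge> 0" if f: "f \<in> positive_forms d" for f and x :: "real ^ 'n"
  proof (cases "x = 0")
    case True
    obtain c where c: "f = (\<lambda>x. \<Sum>\<alpha> | sum \<alpha> UNIV = d. c \<alpha> * (\<Prod>i\<in>UNIV. (x $ i) ^ \<alpha> i))"
      using f by (auto simp: positive_forms_def forms_def)
    have z: "(\<Prod>i\<in>UNIV. (0 :: real) ^ \<alpha> i) = 0" if \<alpha>: "sum \<alpha> UNIV = d" for \<alpha> :: "'n \<Rightarrow> nat"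
    proof -
      obtain i where "\<alpha> i \<noteq> 0" using \<open>d > 0\<close> \<alpha> by (metis less_irrefl sum.neutral)
      then show ?thesis by (auto intro!: bexI[of _ i] prod_zero)
    qed
    then show ?thesis
      unfolding c True by (intro sum_nonneg) (simp only: mem_Collect_eq zero_index z mult_zero_right order_refl)
  qed (use f in \<open>auto simp: positive_forms_def intro: less_imp_le\<close>)
  then have "positive_forms d \<subseteq> {f :: real ^ 'n \<Rightarrow> real. f x \<ge> 0}" for x by auto
  moreover have "closed {f :: real ^ 'n \<Rightarrow> real. f x \<ge> 0}" for x
    by (intro closed_Collect_le continuous_on_const continuous_on_product_coordinates)
  ultimately have "g x \<ge> 0" for x
    using g closure_minimal by blast
  with g show "g \<in> nonneg_forms d" by (simp add: nonneg_forms_def)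
qed

end

theory Submission
  imports Defs
begin

text \<open>
  Fix a point \<open>u\<close> of the unit sphere and write \<open>x'\<close> for the component of \<open>x\<close> orthogonal to
  \<open>u\<close>. On a cone around \<open>u\<close>, genericity and homogeneity give
  \<open>g x \<ge> c |x|^(d - 2) |x'|^2\<close>: at a zero this is the second-order Taylor expansion in the
  directions orthogonal to \<open>u\<close>, elsewhere it is trivial. By compactness of the sphere and
  \<open>d \<ge> 4\<close>, the sublevel set is covered by the unit ball and finitely many
  tubes \<open>|x| |x'| \<le> C\<close>. The part of a tube with \<open>|x \<bullet> u|\<close> of order \<open>2^j\<close> is covered by
  \<open>O(4^j)\<close> cubes of side \<open>O(2^(-j))\<close> centred on the axis, and the total volumes
  \<open>O(2^((2 - n) j))\<close> are summable for \<open>n \<ge> 3\<close>.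
\<close>

section \<open>Tubes around a line\<close>

lemma obtain_dyadic_interval:
  fixes r :: real
  assumes "1 \<le> r"
  obtains j :: nat where "2 ^ j \<le> r" "r < 2 ^ Suc j"
proof -
  obtain N where "r < 2 ^ N"
    using real_arch_pow[of 2 r] by auto
  define m where "m = (LEAST m. r < (2::real) ^ m)"
  have m: "r < 2 ^ m"
    unfolding m_def using \<open>r < 2 ^ N\<close> by (rule LeastI)
  then obtain j where "m = Suc j"
    using assms by (cases m) auto
  moreover have "\<not> r < 2 ^ j"
    using not_less_Least[of j "\<lambda>m. r < (2::real) ^ m"] \<open>m = Suc j\<close> by (simp add: m_def)
  ultimately show thesis
    using that[of j] m by simp
qed

text \<open>For a unit vector \<open>u\<close> this is a neighbourhood of the line through
  \<open>u\<close> whose thickness decays like \<open>C / r\<close> at distance \<open>r\<close>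
  from the origin. It is unbounded for positive \<open>C\<close>, so the finiteness of its volume
  needs an argument.\<close>

definition tube :: "'a::euclidean_space \<Rightarrow> real \<Rightarrow> 'a set" where
  "tube u C = {x. norm x * norm (x - (x \<bullet> u) *\<^sub>R u) \<le> C}"

lemma closed_tube: "closed (tube u C)"
  unfolding tube_def by (intro closed_Collect_le continuous_intros)

text \<open>Since the tube is closed, it suffices to enclose it in a set of finite measure. A
  countable union of cubes serves, because the volumes of its dyadic layers are bounded by a
  geometric series.\<close>

lemma tube_lmeasurable:
  fixes u :: "'a::euclidean_space"
  assumes "DIM('a) \<ge> 3" "norm u = 1"
  shows "tube u C \<in> lmeasurable"
proof -
  \<comment> \<open>The choice gives \<open>M - 1 >= C\<close> and \<open>(M - 1)^2 >= C\<close>,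
    which bound the orthogonal component far from and near the origin. The remaining unit absorbs
    the rounding along the axis.\<close>
  define M where "M = \<bar>C\<bar> + 2"
  have "M > 0" by (simp add: M_def)
  define B :: "nat \<Rightarrow> int \<Rightarrow> 'a set" where
    "B = (\<lambda>j i. cbox ((of_int i / 2 ^ j) *\<^sub>R u - (M / 2 ^ j) *\<^sub>R One) ((of_int i / 2 ^ j) *\<^sub>R u + (M / 2 ^ j) *\<^sub>R One))"
  \<comment> \<open>The centres \<open>i / 2 ^ j\<close> then run through the axial range up to
    \<open>2 ^ Suc j\<close> on both sides of the origin. There are \<open>4 * 4 ^ j + 1\<close> of
    them, at most \<open>5 * 4 ^ j\<close>, whence the 5 in \<open>K\<close>.\<close>
  define I :: "nat \<Rightarrow> int set" where "I = (\<lambda>j. {- (2 * 4 ^ j)..2 * 4 ^ j})"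
  define K where "K = 5 * (2 * M) ^ DIM('a)"
  have "K \<ge> 0" using \<open>M > 0\<close> by (simp add: K_def)
  have B_lmeasurable: "B j i \<in> lmeasurable" for j i
    by (simp add: B_def)
  have B_measure: "measure lebesgue (B j i) = (2 * M) ^ DIM('a) * (1 / 2 ^ j) ^ DIM('a)" for j i
  proof -
    have "measure lebesgue (B j i) = (2 * (M / 2 ^ j)) ^ DIM('a)"
      using \<open>M > 0\<close> by (simp add: B_def content_cbox_if box_ne_empty(1) inner_simps flip: mult_2)
    then show ?thesis by (simp add: power_divide power_mult_distrib)
  qed
  have layer_measure: "measure lebesgue (\<Union>i\<in>I j. B j i) \<le> K * (1/2) ^ j" for j
  proof -
    have "measure lebesgue (\<Union>i\<in>I j. B j i) \<le> (\<Sum>i\<in>I j. measure lebesgue (B j i))"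
      using B_lmeasurable by (intro measure_UNION_le) (auto simp: I_def)
    also have "\<dots> = (4 * 4 ^ j + 1) * ((2 * M) ^ DIM('a) * (1 / 2 ^ j) ^ DIM('a))"
      by (simp add: B_measure I_def)
    \<comment> \<open>The dimension bound enters here: as \<open>1 / 2 ^ j\<close> is at most 1, the
      exponent may be lowered to 3. In dimension two the same count would only give a constant bound
      per layer.\<close>
    also have "\<dots> \<le> (5 * 4 ^ j) * ((2 * M) ^ DIM('a) * (1 / 2 ^ j) ^ 3)"
    proof (rule mult_mono)
      show "(2 * M) ^ DIM('a) * (1 / 2 ^ j) ^ DIM('a) \<le> (2 * M) ^ DIM('a) * (1 / 2 ^ j) ^ 3"
        using assms \<open>M > 0\<close> by (intro mult_left_mono power_decreasing) auto
    qed (use \<open>M > 0\<close> in auto)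
    also have "\<dots> = K * (4 ^ j * (1 / 2 ^ j) ^ 3)"
      by (simp add: K_def)
    also have "4 ^ j * (1 / 2 ^ j) ^ 3 = (1 / 2 :: real) ^ j"
    proof -
      have "(4::real) ^ j = 2 ^ j * 2 ^ j" by (simp flip: power_mult_distrib)
      then show ?thesis by (simp add: power3_eq_cube power_divide)
    qed
    finally show ?thesis .
  qed
  have "(\<Union>j\<in>UNIV. \<Union>i\<in>I j. B j i) \<in> lmeasurable"
  proof (rule fmeasurable_UN_bound)
    fix J :: "nat set" assume "finite J"
    have "measure lebesgue (\<Union>j\<in>J. \<Union>i\<in>I j. B j i) \<le> (\<Sum>j\<in>J. measure lebesgue (\<Union>i\<in>I j. B j i))"
      using B_lmeasurable by (intro measure_UNION_le \<open>finite J\<close>) (auto simp: I_def)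
    also have "\<dots> \<le> (\<Sum>j\<in>J. K * (1/2) ^ j)"
      by (intro sum_mono layer_measure)
    also have "\<dots> \<le> (\<Sum>j. K * (1/2) ^ j)"
      using \<open>finite J\<close> \<open>K \<ge> 0\<close> by (intro sum_le_suminf summable_mult summable_geometric) auto
    finally show "measure lebesgue (\<Union>j\<in>J. \<Union>i\<in>I j. B j i) \<le> (\<Sum>j. K * (1/2) ^ j)" .
  qed (auto intro!: fmeasurable.finite_UN simp: I_def B_lmeasurable)
  moreover have "tube u C \<subseteq> (\<Union>j. \<Union>i\<in>I j. B j i)"
  proof
    fix x assume x: "x \<in> tube u C"
    define t where "t = x \<bullet> u"
    define y where "y = x - t *\<^sub>R u"
    have xy: "norm x * norm y \<le> C"
      using x by (simp add: tube_def y_def t_def)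
    have tx: "\<bar>t\<bar> \<le> norm x"
      using Cauchy_Schwarz_ineq2[of x u] assms by (simp add: t_def)
    \<comment> \<open>Both cases below use this: the layer is the dyadic exponent of
      \<open>\<bar>t\<bar>\<close> if that is at least 1, and layer 0 otherwise.\<close>
    have mem: "x \<in> (\<Union>j. \<Union>i\<in>I j. B j i)"
      if t: "\<bar>t\<bar> \<le> 2 ^ Suc j" and y: "norm y \<le> (M - 1) / 2 ^ j" for j
    proof -
      define i where "i = \<lfloor>t * 2 ^ j\<rfloor>"
      have four: "(4::real) ^ j = 2 ^ j * 2 ^ j" by (simp flip: power_mult_distrib)
      have "\<bar>t * 2 ^ j\<bar> \<le> 2 * 4 ^ j"
        using mult_right_mono[OF t, of "2 ^ j"] by (simp add: abs_mult four)
      then have "- (2 * 4 ^ j) \<le> t * 2 ^ j" "t * 2 ^ j \<le> 2 * 4 ^ j" by linarith+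
      then have "i \<in> I j"
        unfolding i_def I_def by (auto simp: le_floor_iff intro: floor_le_iff[THEN iffD2])
      have "\<bar>t * 2 ^ j - of_int i\<bar> \<le> 1"
        unfolding i_def by linarith
      then have "\<bar>t - of_int i / 2 ^ j\<bar> \<le> 1 / 2 ^ j"
        by (simp add: abs_le_iff field_simps)
      moreover have "x - (of_int i / 2 ^ j) *\<^sub>R u = y + (t - of_int i / 2 ^ j) *\<^sub>R u"
        by (simp add: y_def scaleR_diff_left)
      \<comment> \<open>The orthogonal part contributes \<open>(M - 1) / 2 ^ j\<close> and the
        rounding of \<open>t\<close> contributes \<open>1 / 2 ^ j\<close>.\<close>
      ultimately have near: "norm (x - (of_int i / 2 ^ j) *\<^sub>R u) \<le> M / 2 ^ j"
        using norm_triangle_ineq[of y "(t - of_int i / 2 ^ j) *\<^sub>R u"] y assms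
        by (simp add: diff_divide_distrib)
      have "\<bar>x \<bullet> b - ((of_int i / 2 ^ j) *\<^sub>R u) \<bullet> b\<bar> \<le> M / 2 ^ j" if "b \<in> Basis" for b
        using Basis_le_norm[OF that, of "x - (of_int i / 2 ^ j) *\<^sub>R u"] near
        by (simp only: inner_diff_left)
      then have "x \<in> B j i"
        unfolding B_def mem_box inner_diff_left inner_add_left
        by (fastforce simp: abs_le_iff)
      with \<open>i \<in> I j\<close> show ?thesis by blast
    qed
    show "x \<in> (\<Union>j. \<Union>i\<in>I j. B j i)"
    proof (cases "1 \<le> \<bar>t\<bar>")
      case True
      then obtain j where j: "2 ^ j \<le> \<bar>t\<bar>" "\<bar>t\<bar> < 2 ^ Suc j"
        by (rule obtain_dyadic_interval)
      have "2 ^ j * norm y \<le> norm x * norm y"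
        using j tx by (intro mult_right_mono) auto
      also have "\<dots> \<le> M - 1"
        using xy by (simp add: M_def)
      finally have "norm y \<le> (M - 1) / 2 ^ j"
        by (simp add: field_simps)
      then show ?thesis using mem[of j] j by auto
    next
      case False
      \<comment> \<open>Near the origin \<open>\<bar>t\<bar>\<close> gives no lower bound on
        \<open>norm x\<close>, so \<open>norm y \<le> norm x\<close> is used to turn the tube
        inequality into a bound on the square of \<open>norm y\<close>.\<close>
      have "u \<bullet> u = 1" using assms by (simp add: dot_square_norm)
      then have "y \<bullet> (t *\<^sub>R u) = 0"
        by (simp add: y_def t_def inner_diff_left)
      then have "norm x ^ 2 = norm y ^ 2 + norm (t *\<^sub>R u) ^ 2"
        using norm_add_Pythagorean[of y "t *\<^sub>R u"] by (simp add: y_def orthogonal_def)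
      then have "norm y \<le> norm x"
        by (intro power2_le_imp_le[of "norm y" "norm x", OF _ norm_ge_zero]) simp
      then have "(norm y)\<^sup>2 \<le> C"
        using xy mult_right_mono[of "norm y" "norm x" "norm y"] by (simp add: power2_eq_square)
      also have "C \<le> (M - 1)\<^sup>2"
        using self_le_power[of "M - 1" 2] by (simp add: M_def)
      finally have "norm y \<le> M - 1"
        by (rule power2_le_imp_le) (simp add: M_def)
      then show ?thesis using mem[of 0] False by auto
    qed
  qed
  ultimately show ?thesis
    by (rule fmeasurableI2) (simp add: closed_tube borel_closed)
qed

section \<open>Second-order expansion of polynomial functions\<close>

text \<open>By induction on the construction of polynomial functions. That the derivatives are
  polynomial again allows a second application, which yields the Hessian and its continuity.\<close>

lemma real_polynomial_function_gradient:
  fixes f :: "real ^ 'n \<Rightarrow> real"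
  assumes "real_polynomial_function f"
  shows "\<exists>D. (\<forall>i. real_polynomial_function (D i)) \<and>
    (\<forall>x. (f has_derivative (\<lambda>v. \<Sum>i\<in>UNIV. v $ i * D i x)) (at x))"
  using assms
proof (induction rule: real_polynomial_function.induct)
  case (linear f)
  have eq: "f v = (\<Sum>i\<in>UNIV. v $ i * f (axis i 1))" for v
  proof -
    have "linear f" using linear bounded_linear.linear by blast
    then have "f (\<Sum>i\<in>UNIV. (v $ i) *\<^sub>R axis i 1) = (\<Sum>i\<in>UNIV. v $ i * f (axis i 1))"
      by (simp add: linear_sum linear_scale)
    then show ?thesis
      using basis_expansion[of v] by (simp add: scalar_mult_eq_scaleR)
  qed
  have "(f has_derivative (\<lambda>v. \<Sum>i\<in>UNIV. v $ i * f (axis i 1))) (at x)" for x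
    using bounded_linear_imp_has_derivative[OF linear] by (rule has_derivative_eq_rhs) (rule ext, rule eq)
  then show ?case
    by (intro exI[of _ "\<lambda>i x. f (axis i 1)"]) (simp add: real_polynomial_function.intros(2))
next
  case (const c)
  show ?case
  proof (rule exI[of _ "\<lambda>i x. 0"], intro conjI allI)
    show "((\<lambda>_. c) has_derivative (\<lambda>v. \<Sum>i\<in>UNIV. v $ i * 0)) (at x)" for x :: "real ^ 'n"
      using has_derivative_const[of c "at x"] by simp
  qed (rule real_polynomial_function.intros(2))
next
  case (add f g)
  obtain D where
    D: "\<forall>i. real_polynomial_function (D i)"
      "\<And>x. (f has_derivative (\<lambda>v. \<Sum>i\<in>UNIV. v $ i * D i x)) (at x)"
    using add.IH(1) by blast
  obtain E where
    E: "\<forall>i. real_polynomial_function (E i)"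
      "\<And>x. (g has_derivative (\<lambda>v. \<Sum>i\<in>UNIV. v $ i * E i x)) (at x)"
    using add.IH(2) by blast
  have "((\<lambda>x. f x + g x) has_derivative (\<lambda>v. \<Sum>i\<in>UNIV. v $ i * (D i x + E i x))) (at x)" for x
    using has_derivative_add[OF D(2) E(2)] by (simp add: sum.distrib distrib_left)
  with D(1) E(1) show ?case
    by (intro exI[of _ "\<lambda>i x. D i x + E i x"]) (simp add: real_polynomial_function.intros(3))
next
  case (mult f g)
  obtain D where
    D: "\<forall>i. real_polynomial_function (D i)"
      "\<And>x. (f has_derivative (\<lambda>v. \<Sum>i\<in>UNIV. v $ i * D i x)) (at x)"
    using mult.IH(1) by blast
  obtain E where
    E: "\<forall>i. real_polynomial_function (E i)"
      "\<And>x. (g has_derivative (\<lambda>v. \<Sum>i\<in>UNIV. v $ i * E i x)) (at x)"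
    using mult.IH(2) by blast
  have "((\<lambda>x. f x * g x) has_derivative
      (\<lambda>v. \<Sum>i\<in>UNIV. v $ i * (f x * E i x + D i x * g x))) (at x)" for x
  proof (rule has_derivative_eq_rhs[OF has_derivative_mult[OF D(2) E(2)]])
    show "(\<lambda>v. f x * (\<Sum>i\<in>UNIV. v $ i * E i x) + (\<Sum>i\<in>UNIV. v $ i * D i x) * g x) =
        (\<lambda>v. \<Sum>i\<in>UNIV. v $ i * (f x * E i x + D i x * g x))"
      by (simp add: sum_distrib_left sum_distrib_right sum.distrib algebra_simps)
  qed
  with D(1) E(1) mult.hyps show ?case
    by (intro exI[of _ "\<lambda>i x. f x * E i x + D i x * g x"])
      (simp add: real_polynomial_function.intros(3,4))
qed

lemma has_real_derivative_along_line:
  fixes f :: "real ^ 'n \<Rightarrow> real"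
  assumes "(f has_derivative (\<lambda>v. \<Sum>i\<in>UNIV. v $ i * D i)) (at (a + t *\<^sub>R v))"
  shows "((\<lambda>s. f (a + s *\<^sub>R v)) has_real_derivative (\<Sum>i\<in>UNIV. v $ i * D i)) (at t)"
proof -
  have "((\<lambda>s. a + s *\<^sub>R v) has_derivative (\<lambda>s. s *\<^sub>R v)) (at t)"
    by (auto intro!: derivative_eq_intros)
  from has_derivative_compose[OF this assms]
  show ?thesis
    by (rule has_derivative_imp_has_field_derivative) (simp add: sum_distrib_left sum_distrib_right ac_simps)
qed

text \<open>Restriction to coordinate lines identifies the coefficients of the gradient above with
  the one-variable limits in \<open>partial_deriv\<close>.\<close>

lemma real_polynomial_function_partial_deriv:
  fixes f :: "real ^ 'n \<Rightarrow> real"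
  assumes "real_polynomial_function f"
  shows "real_polynomial_function (partial_deriv i f)"
    and "(f has_derivative (\<lambda>v. \<Sum>i\<in>UNIV. v $ i * partial_deriv i f x)) (at x)"
proof -
  obtain D where D: "\<forall>i. real_polynomial_function (D i)"
      "\<And>x. (f has_derivative (\<lambda>v. \<Sum>i\<in>UNIV. v $ i * D i x)) (at x)"
    using real_polynomial_function_gradient[OF assms] by blast
  have eq: "partial_deriv i f = D i" for i
  proof
    fix x
    have "((\<lambda>s. f (x + s *\<^sub>R axis i 1)) has_real_derivative
        (\<Sum>j\<in>UNIV. axis i 1 $ j * D j x)) (at 0)"
      using D(2)[of x] by (intro has_real_derivative_along_line) simp
    moreover have "(\<Sum>j\<in>UNIV. axis i 1 $ j * D j x) = D i x"
      by (simp add: axis_def if_distrib[of "\<lambda>a. a * _"] cong: if_cong)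
    ultimately show "partial_deriv i f x = D i x"
      unfolding partial_deriv_def by (simp add: DERIV_imp_deriv)
  qed
  show "real_polynomial_function (partial_deriv i f)"
    using D eq by simp
  show "(f has_derivative (\<lambda>v. \<Sum>i\<in>UNIV. v $ i * partial_deriv i f x)) (at x)"
    using D eq by simp
qed

lemma quadratic_form_eq_sum:
  fixes A :: "real ^ 'n ^ 'n"
  shows "v \<bullet> (A *v v) = (\<Sum>i\<in>UNIV. \<Sum>j\<in>UNIV. v $ i * v $ j * A $ i $ j)"
  by (simp add: inner_vec_def matrix_vector_mult_def sum_distrib_left ac_simps)

text \<open>Serves to carry positivity of the Hessian from a zero to nearby points. The entrywise
  sum is a crude bound, but it visibly depends continuously on the entries.\<close>

lemma quadratic_form_diff_le:
  fixes A B :: "real ^ 'n ^ 'n"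
  shows "\<bar>v \<bullet> (A *v v) - v \<bullet> (B *v v)\<bar> \<le>
    (\<Sum>i\<in>UNIV. \<Sum>j\<in>UNIV. \<bar>A $ i $ j - B $ i $ j\<bar>) * (norm v)\<^sup>2"
proof -
  have "\<bar>v \<bullet> (A *v v) - v \<bullet> (B *v v)\<bar> =
      \<bar>\<Sum>i\<in>UNIV. \<Sum>j\<in>UNIV. v $ i * v $ j * (A $ i $ j - B $ i $ j)\<bar>"
    by (simp add: quadratic_form_eq_sum sum_subtractf algebra_simps)
  also have "\<dots> \<le> (\<Sum>i\<in>UNIV. \<Sum>j\<in>UNIV. \<bar>v $ i * v $ j * (A $ i $ j - B $ i $ j)\<bar>)"
    by (intro order_trans[OF sum_abs] sum_mono sum_abs)
  also have "\<dots> \<le> (\<Sum>i\<in>UNIV. \<Sum>j\<in>UNIV. \<bar>A $ i $ j - B $ i $ j\<bar> * (norm v)\<^sup>2)"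
  proof (intro sum_mono)
    fix i j
    have "\<bar>v $ i\<bar> * \<bar>v $ j\<bar> \<le> norm v * norm v"
      by (intro mult_mono component_le_norm_cart) auto
    then show "\<bar>v $ i * v $ j * (A $ i $ j - B $ i $ j)\<bar> \<le> \<bar>A $ i $ j - B $ i $ j\<bar> * (norm v)\<^sup>2"
      by (simp add: abs_mult power2_eq_square mult.commute[of "norm v * norm v"]
          mult.commute[of "_ * _" "\<bar>A $ i $ j - B $ i $ j\<bar>"] mult_left_mono)
  qed
  finally show ?thesis
    by (simp add: sum_distrib_right)
qed

text \<open>Taylor's formula with Lagrange remainder on the segment from \<open>a\<close> to
  \<open>a + v\<close>: the zero \<open>a\<close> minimises the non-negative \<open>f\<close>, so
  the constant and linear terms vanish.\<close>

lemma second_order_lower_bound: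
  fixes f :: "real ^ 'n \<Rightarrow> real"
  assumes f: "real_polynomial_function f" and nonneg: "\<And>x. f x \<ge> 0" and "f a = 0"
    and hess: "\<And>t. \<lbrakk>0 < t; t < 1\<rbrakk> \<Longrightarrow> q \<le> v \<bullet> (hessian f (a + t *\<^sub>R v) *v v)"
  shows "q / 2 \<le> f (a + v)"
proof -
  note poly = real_polynomial_function_partial_deriv
  \<comment> \<open>The derivative sequence in the shape that \<open>Maclaurin\<close> expects; only
    the indices 0, 1 and 2 matter, and the value at larger indices is arbitrary.\<close>
  define h where "h = (\<lambda>m::nat. if m = 0 then (\<lambda>t. f (a + t *\<^sub>R v))
    else if m = 1 then (\<lambda>t. \<Sum>j\<in>UNIV. v $ j * partial_deriv j f (a + t *\<^sub>R v))
    else (\<lambda>t. v \<bullet> (hessian f (a + t *\<^sub>R v) *v v)))"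
  have d0: "(h 0 has_real_derivative h 1 t) (at t)" for t
    unfolding h_def using has_real_derivative_along_line[OF poly(2)[OF f]] by simp
  have "((\<lambda>t. \<Sum>j\<in>UNIV. v $ j * partial_deriv j f (a + t *\<^sub>R v)) has_real_derivative
      (\<Sum>j\<in>UNIV. v $ j * (\<Sum>i\<in>UNIV. v $ i * partial_deriv i (partial_deriv j f) (a + t *\<^sub>R v)))) (at t)" for t
    by (intro DERIV_sum DERIV_cmult has_real_derivative_along_line poly f)
  moreover have "(\<Sum>j\<in>UNIV. v $ j * (\<Sum>i\<in>UNIV. v $ i * partial_deriv i (partial_deriv j f) x))
      = v \<bullet> (hessian f x *v v)" for x
    unfolding quadratic_form_eq_sum hessian_def sum_distrib_left
    by (subst sum.swap) (simp add: ac_simps)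
  ultimately have d1: "(h 1 has_real_derivative h 2 t) (at t)" for t
    unfolding h_def by simp
  have "h 1 0 = 0"
    using d0[of 0] by (rule DERIV_local_min[of _ _ _ 1]) (auto simp: h_def nonneg \<open>f a = 0\<close>)
  have "\<exists>t>0. t < 1 \<and> h 0 1 = (\<Sum>m<2. h m 0 / fact m * 1 ^ m) + h 2 t / fact 2 * 1 ^ 2"
    using d0 d1 unfolding One_nat_def by (intro Maclaurin) (auto simp: less_2_cases_iff simp flip: numeral_2_eq_2)
  then obtain t where t: "0 < t" "t < 1" "h 0 1 = h 2 t / 2"
    using \<open>h 1 0 = 0\<close> \<open>f a = 0\<close> by (auto simp: lessThan_nat_numeral lessThan_Suc h_def)
  then show ?thesis
    using hess[OF t(1,2)] by (simp add: h_def)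
qed

section \<open>Lower bounds for generic forms\<close>

lemma forms_homogeneous:
  assumes "g \<in> forms d"
  shows "g (t *\<^sub>R x) = t ^ d * g x"
proof -
  obtain c where c: "g = (\<lambda>x. \<Sum>\<alpha> | sum \<alpha> UNIV = d. c \<alpha> * (\<Prod>i\<in>UNIV. (x $ i) ^ \<alpha> i))"
    using assms by (auto simp: forms_def)
  have "(\<Prod>i\<in>UNIV. ((t *\<^sub>R x) $ i) ^ \<alpha> i) = t ^ d * (\<Prod>i\<in>UNIV. (x $ i) ^ \<alpha> i)"
    if "sum \<alpha> UNIV = d" for \<alpha>
    using that by (auto simp: power_mult_distrib prod.distrib power_sum)
  then show ?thesis
    unfolding c by (auto simp: sum_distrib_left intro!: sum.cong)
qed

lemma forms_real_polynomial_function: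
  assumes "g \<in> forms d"
  shows "real_polynomial_function g"
proof -
  obtain c where c: "g = (\<lambda>x. \<Sum>\<alpha> | sum \<alpha> UNIV = d. c \<alpha> * (\<Prod>i\<in>UNIV. (x $ i) ^ \<alpha> i))"
    using assms by (auto simp: forms_def)
  show ?thesis
    unfolding c
    by (intro real_polynomial_function_sum finite_exponents real_polynomial_function.intros(4)
        real_polynomial_function.intros(2) real_polynomial_function_prod finite
        real_polynomial_function_power real_polynomial_function.intros(1) bounded_linear_vec_nth)
qed

lemma real_polynomial_function_continuous:
  "real_polynomial_function f \<Longrightarrow> continuous_on S f"
  by (simp add: real_polynomial_function_eq continuous_on_polymonial_function)

text \<open>Compactness makes the positive definiteness of the Hessian on the orthogonal complement
  of \<open>u\<close> uniform, and continuity preserves half of it nearby. Along \<open>u\<close>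
  itself no such bound can hold, since \<open>g\<close> vanishes on that line.\<close>

lemma generic_form_transversal_lower_bound:
  fixes g :: "real ^ 'n \<Rightarrow> real"
  assumes g: "g \<in> nonneg_forms d" and gen: "generic_form g" and u: "norm u = 1" "g u = 0"
  obtains c e where "c > 0" "e > 0"
    "\<And>v. \<lbrakk>orthogonal u v; norm v < e\<rbrakk> \<Longrightarrow> c * (norm v)\<^sup>2 \<le> g (u + v)"
proof -
  have poly: "real_polynomial_function g"
    using g forms_real_polynomial_function by (auto simp: nonneg_forms_def)
  define Q where "Q = (\<lambda>w. w \<bullet> (hessian g u *v w))"
  have scale: "Q (r *\<^sub>R w) = r\<^sup>2 * Q w" for r w
    by (simp add: Q_def matrix_vector_mult_scaleR power2_eq_square)
  have Q_pos: "Q w > 0" if "w \<noteq> 0" "orthogonal u w" for w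
    using gen u that unfolding generic_form_def Q_def by (metis norm_zero zero_neq_one)
  obtain m where m: "m > 0" "\<And>w. orthogonal u w \<Longrightarrow> m * (norm w)\<^sup>2 \<le> Q w"
  proof -
    define S where "S = sphere 0 1 \<inter> {w. u \<bullet> w = 0}"
    have "compact S"
      unfolding S_def by (intro compact_Int_closed compact_sphere closed_hyperplane)
    have cont: "continuous_on S Q"
      unfolding Q_def by (intro continuous_intros)
    have norm_case: "(1 / norm w) *\<^sub>R w \<in> S" if "w \<noteq> 0" "orthogonal u w" for w
      using that by (simp add: S_def orthogonal_def)
    have "\<exists>m>0. \<forall>w\<in>S. m \<le> Q w"
    \<comment> \<open>With a single variable the orthogonal complement of \<open>u\<close> is
      trivial and \<open>S\<close> is empty; any positive \<open>m\<close> will do.\<close>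
    proof (cases "S = {}")
      case False
      then obtain w0 where w0: "w0 \<in> S" "\<And>w. w \<in> S \<Longrightarrow> Q w0 \<le> Q w"
        using continuous_attains_inf[OF \<open>compact S\<close> _ cont] by blast
      then have "Q w0 > 0" by (intro Q_pos) (auto simp: S_def orthogonal_def)
      with w0 show ?thesis by blast
    qed (auto intro: exI[of _ 1])
    then obtain m where m: "m > 0" "\<And>w. w \<in> S \<Longrightarrow> m \<le> Q w" by blast
    have "m * (norm w)\<^sup>2 \<le> Q w" if w: "orthogonal u w" for w
    proof (cases "w = 0")
      case False
      have "m \<le> (1 / norm w)\<^sup>2 * Q w"
        using m(2)[OF norm_case[OF False w]] by (simp only: scale)
      then show ?thesis using False by (simp add: field_simps)
    qed (simp add: Q_def)
    with m(1) that show thesis by blast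
  qed
  define E where "E = (\<lambda>z. \<Sum>i\<in>UNIV. \<Sum>j\<in>UNIV. \<bar>hessian g z $ i $ j - hessian g u $ i $ j\<bar>)"
  have "continuous_on UNIV E"
    unfolding E_def hessian_def vec_lambda_beta
    by (intro continuous_on_sum continuous_on_rabs continuous_on_diff continuous_on_const
        real_polynomial_function_continuous real_polynomial_function_partial_deriv poly)
  moreover have "E u = 0" by (simp add: E_def)
  ultimately obtain e where e: "e > 0" "\<And>z. dist z u < e \<Longrightarrow> E z < m / 2"
    using m(1) unfolding continuous_on_iff
    by (metis UNIV_I abs_less_iff diff_zero dist_real_def half_gt_zero)
  \<comment> \<open>One factor 1/2 is lost to the variation of the Hessian, the other is the Taylor
    coefficient.\<close>
  have "m / 4 * (norm v)\<^sup>2 \<le> g (u + v)" if v: "orthogonal u v" "norm v < e" for v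
  proof -
    have "m / 2 * (norm v)\<^sup>2 \<le> v \<bullet> (hessian g (u + t *\<^sub>R v) *v v)" if t: "0 < t" "t < 1" for t
    proof -
      have "t * norm v \<le> norm v"
        using t by (simp add: mult_left_le_one_le)
      then have "E (u + t *\<^sub>R v) < m / 2"
        using t v by (intro e(2)) (simp add: dist_norm)
      then have "E (u + t *\<^sub>R v) * (norm v)\<^sup>2 \<le> m / 2 * (norm v)\<^sup>2"
        by (intro mult_right_mono) auto
      then show ?thesis
        using quadratic_form_diff_le[of v "hessian g (u + t *\<^sub>R v)" "hessian g u"] m(2)[OF v(1)]
        unfolding E_def Q_def by linarith
    qed
    then have "m / 2 * (norm v)\<^sup>2 / 2 \<le> g (u + v)"
      using g u by (intro second_order_lower_bound[OF poly]) (auto simp: nonneg_forms_def)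
    then show ?thesis by simp
  qed
  with that[of "m / 4" e] m e show thesis by simp
qed

text \<open>At a zero, points near \<open>u\<close> are rescaled onto the affine hyperplane through
  \<open>u\<close> orthogonal to \<open>u\<close>, where the transversal bound applies, and
  homogeneity carries it back. Elsewhere \<open>g\<close> is bounded below near \<open>u\<close> by
  a positive constant.\<close>

lemma generic_form_local_lower_bound:
  fixes g :: "real ^ 'n \<Rightarrow> real"
  assumes g: "g \<in> nonneg_forms d" and gen: "generic_form g" and u: "norm u = 1" and "d \<ge> 2"
  shows "\<exists>c e. c > 0 \<and> e > 0 \<and>
    (\<forall>x. norm x = 1 \<longrightarrow> dist u x < e \<longrightarrow> c * (norm (x - (x \<bullet> u) *\<^sub>R u))\<^sup>2 \<le> g x)"
proof (cases "g u = 0")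
  case True
  have form: "g \<in> forms d" using g by (simp add: nonneg_forms_def)
  obtain c e where ce: "c > 0" "e > 0"
    "\<And>v. \<lbrakk>orthogonal u v; norm v < e\<rbrakk> \<Longrightarrow> c * (norm v)\<^sup>2 \<le> g (u + v)"
    using generic_form_transversal_lower_bound[OF g gen u True] by metis
  \<comment> \<open>Central projection onto that hyperplane, with \<open>u\<close> moved to the
    origin.\<close>
  define \<phi> where "\<phi> = (\<lambda>x. (1 / (x \<bullet> u)) *\<^sub>R x - u)"
  have uu: "u \<bullet> u = 1" using u by (simp add: dot_square_norm)
  have "isCont (\<lambda>x. x \<bullet> u) u" by (intro continuous_intros)
  \<comment> \<open>Staying above 1/2 makes the division by \<open>x \<bullet> u\<close> harmless
    and bounds its powers from below.\<close>
  then obtain e1 where e1: "e1 > 0" "\<And>x. dist x u < e1 \<Longrightarrow> dist (x \<bullet> u) (u \<bullet> u) < 1 / 2"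
    unfolding continuous_at_eps_delta by (metis half_gt_zero_iff zero_less_one)
  have "isCont (\<lambda>x. norm (\<phi> x)) u"
    unfolding \<phi>_def using uu by (intro continuous_intros) auto
  then obtain e2 where e2: "e2 > 0" "\<And>x. dist x u < e2 \<Longrightarrow> dist (norm (\<phi> x)) (norm (\<phi> u)) < e"
    unfolding continuous_at_eps_delta using ce(2) by blast
  have "c * (1/2) ^ (d - 2) * (norm (x - (x \<bullet> u) *\<^sub>R u))\<^sup>2 \<le> g x"
    if x: "dist u x < min e1 e2" for x
  proof -
    define t where "t = x \<bullet> u"
    have t: "t > 1 / 2"
      using e1(2)[of x] x uu unfolding t_def dist_real_def dist_commute[of u] by linarith
    have eq: "x = t *\<^sub>R (u + \<phi> x)" "x - t *\<^sub>R u = t *\<^sub>R \<phi> x"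
      using t by (simp_all add: \<phi>_def t_def[symmetric] scaleR_diff_right)
    have "orthogonal u (\<phi> x)"
      using t uu by (simp add: \<phi>_def orthogonal_def inner_diff_right inner_commute t_def)
    moreover have "norm (\<phi> x) < e"
      using e2(2)[of x] x uu by (simp add: dist_commute[of u] \<phi>_def dist_real_def)
    ultimately have "c * (norm (\<phi> x))\<^sup>2 \<le> g (u + \<phi> x)"
      by (rule ce(3))
    then have "t ^ d * (c * (norm (\<phi> x))\<^sup>2) \<le> t ^ d * g (u + \<phi> x)"
      using t by (intro mult_left_mono) auto
    also have "\<dots> = g x"
      using forms_homogeneous[OF form, of t "u + \<phi> x"] eq(1) by simp
    finally have *: "t ^ d * (c * (norm (\<phi> x))\<^sup>2) \<le> g x" .
    \<comment> \<open>Of the \<open>d\<close> factors \<open>t\<close>, two turn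
      \<open>\<phi> x\<close> into the orthogonal component of \<open>x\<close>; the others are
      estimated by 1/2.\<close>
    have "c * (1/2) ^ (d - 2) * (norm (x - t *\<^sub>R u))\<^sup>2 \<le> c * t ^ (d - 2) * (norm (x - t *\<^sub>R u))\<^sup>2"
      using t ce by (intro mult_right_mono mult_left_mono power_mono) auto
    also have "\<dots> = (t ^ (d - 2) * t\<^sup>2) * (c * (norm (\<phi> x))\<^sup>2)"
      unfolding eq(2) by (simp add: power_mult_distrib)
    also have "t ^ (d - 2) * t\<^sup>2 = t ^ d"
      using \<open>d \<ge> 2\<close> by (metis power_add le_add_diff_inverse2)
    finally show ?thesis using * by (simp add: t_def)
  qed
  then show ?thesis
    using ce e1 e2 by (intro exI[of _ "c * (1/2) ^ (d - 2)"] exI[of _ "min e1 e2"]) auto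
next
  case False
  then have "g u > 0" using g by (auto simp: nonneg_forms_def order_less_le)
  have "continuous_on UNIV g"
    using g by (intro real_polynomial_function_continuous forms_real_polynomial_function[of g d])
      (simp add: nonneg_forms_def)
  then obtain e where e: "e > 0" "\<And>x. dist x u < e \<Longrightarrow> dist (g x) (g u) < g u / 2"
    using \<open>g u > 0\<close> unfolding continuous_on_iff by (metis UNIV_I half_gt_zero)
  \<comment> \<open>The orthogonal component has norm at most 2, so the left side is at most
    \<open>g u / 2\<close>.\<close>
  have "g u / 8 * (norm (x - (x \<bullet> u) *\<^sub>R u))\<^sup>2 \<le> g x" if x: "norm x = 1" "dist u x < e" for x
  proof -
    have "\<bar>x \<bullet> u\<bar> \<le> 1"
      using Cauchy_Schwarz_ineq2[of x u] x u by simp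
    then have "norm (x - (x \<bullet> u) *\<^sub>R u) \<le> 2"
      using norm_triangle_ineq4[of x "(x \<bullet> u) *\<^sub>R u"] x u by simp
    then have "(norm (x - (x \<bullet> u) *\<^sub>R u))\<^sup>2 \<le> 2\<^sup>2"
      by (intro power_mono) auto
    then have "g u / 8 * (norm (x - (x \<bullet> u) *\<^sub>R u))\<^sup>2 \<le> g u / 8 * 4"
      using \<open>g u > 0\<close> by (intro mult_left_mono) auto
    moreover have "g x > g u / 2"
      using e(2)[of x] x unfolding dist_real_def dist_commute[of u] by linarith
    ultimately show ?thesis by simp
  qed
  then show ?thesis
    using e \<open>g u > 0\<close> by (intro exI[of _ "g u / 8"] exI[of _ e]) auto
qed

section \<open>Covering the sublevel set by tubes\<close>

text \<open>Homogeneity scales the bound on the sphere by \<open>r ^ d\<close>. Squaring the product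
  that defines the tube uses up only \<open>r ^ 4\<close>.\<close>

lemma sublevel_point_in_tube:
  fixes g :: "real ^ 'n \<Rightarrow> real"
  assumes g: "g \<in> forms d" and "d \<ge> 4" and "c > 0" and x: "norm x \<ge> 1" "g x \<le> 1"
    and lower: "c * (norm (sgn x - (sgn x \<bullet> u) *\<^sub>R u))\<^sup>2 \<le> g (sgn x)"
  shows "x \<in> tube u (sqrt (1 / c))"
proof -
  define r where "r = norm x"
  have r: "r \<ge> 1" using x by (simp add: r_def)
  have xr: "x = r *\<^sub>R sgn x"
    using r by (cases "x = 0") (auto simp: r_def sgn_div_norm)
  define p where "p = norm (sgn x - (sgn x \<bullet> u) *\<^sub>R u)"
  have "x - (x \<bullet> u) *\<^sub>R u = r *\<^sub>R (sgn x - (sgn x \<bullet> u) *\<^sub>R u)"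
    by (subst (1 2) xr) (simp add: scaleR_diff_right)
  then have perp: "norm (x - (x \<bullet> u) *\<^sub>R u) = r * p"
    using r by (simp add: p_def)
  have "c * (r * (r * p))\<^sup>2 = r ^ 4 * (c * p\<^sup>2)"
    by (simp add: power_mult_distrib flip: power_add)
  \<comment> \<open>This is where the degree bound and the restriction to points outside the open
    unit ball are combined.\<close>
  also have "\<dots> \<le> r ^ d * (c * p\<^sup>2)"
    using r \<open>d \<ge> 4\<close> \<open>c > 0\<close> by (intro mult_right_mono power_increasing) auto
  also have "\<dots> \<le> r ^ d * g (sgn x)"
    using r lower by (intro mult_left_mono) (auto simp: p_def)
  also have "\<dots> = g x"
    using forms_homogeneous[OF g, of r "sgn x"] xr by simp
  finally have "(r * (r * p))\<^sup>2 \<le> 1 / c"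
    using x \<open>c > 0\<close> by (simp add: field_simps)
  then have "r * (r * p) \<le> sqrt (1 / c)"
    by (rule real_le_rsqrt)
  then show ?thesis
    by (simp add: tube_def perp flip: r_def)
qed

theorem theorem1p12:
  fixes d :: nat and g :: "real ^ 'n \<Rightarrow> real"
  assumes "even d" and "d \<ge> 4"
    and "CARD('n) \<ge> 3"
    and "g \<in> nonneg_forms d"
    and "generic_form g"
  shows "g \<in> finite_volume_forms d"
proof -
  have form: "g \<in> forms d" using assms by (simp add: nonneg_forms_def)
  have "\<forall>u. \<exists>c e. norm u = 1 \<longrightarrow> c > 0 \<and> e > 0 \<and>
      (\<forall>x. norm x = 1 \<longrightarrow> dist u x < e \<longrightarrow> c * (norm (x - (x \<bullet> u) *\<^sub>R u))\<^sup>2 \<le> g x)"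
    using generic_form_local_lower_bound[OF assms(4,5)] assms(2) by force
  then obtain c e where ce: "\<And>u. norm u = 1 \<Longrightarrow> c u > 0 \<and> e u > 0 \<and>
      (\<forall>x. norm x = 1 \<longrightarrow> dist u x < e u \<longrightarrow> c u * (norm (x - (x \<bullet> u) *\<^sub>R u))\<^sup>2 \<le> g x)"
    by metis
  \<comment> \<open>Compactness leaves finitely many centres \<open>u\<close>; a point outside the
    unit ball is assigned to a centre by its direction \<open>sgn x\<close>.\<close>
  have "sphere 0 1 \<subseteq> (\<Union>u\<in>sphere 0 1. ball u (e u))"
    using ce by force
  then obtain U where U: "U \<subseteq> sphere 0 1" "finite U" "sphere 0 1 \<subseteq> (\<Union>u\<in>U. ball u (e u))"
    by (rule compactE_image[OF compact_sphere, rotated]) auto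
  have "{x. g x \<le> 1} \<subseteq> cball 0 1 \<union> (\<Union>u\<in>U. tube u (sqrt (1 / c u)))"
  proof
    fix x assume x: "x \<in> {x. g x \<le> 1}"
    show "x \<in> cball 0 1 \<union> (\<Union>u\<in>U. tube u (sqrt (1 / c u)))"
    proof (cases "norm x \<le> 1")
      case False
      then have "norm (sgn x) = 1" by (auto simp: norm_sgn)
      then obtain u where "u \<in> U" "dist u (sgn x) < e u"
        using U(3) by force
      moreover from this have "norm u = 1" using U(1) by auto
      ultimately have "x \<in> tube u (sqrt (1 / c u))"
        using False x ce[of u] \<open>norm (sgn x) = 1\<close>
        by (intro sublevel_point_in_tube[OF form \<open>d \<ge> 4\<close>]) auto
      with \<open>u \<in> U\<close> show ?thesis by blast
    qed auto
  qed
  moreover have "cball 0 1 \<union> (\<Union>u\<in>U. tube u (sqrt (1 / c u))) \<in> lmeasurable"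
    using U by (intro fmeasurable.Un fmeasurable.finite_UN tube_lmeasurable) (auto simp: assms(3))
  moreover have "closed {x. g x \<le> 1}"
    by (intro closed_Collect_le continuous_intros real_polynomial_function_continuous
        forms_real_polynomial_function[OF form])
  then have "{x. g x \<le> 1} \<in> sets lebesgue"
    by (simp add: borel_closed)
  ultimately have "{x. g x \<le> 1} \<in> lmeasurable"
    by (metis fmeasurableI2)
  with form show ?thesis by (simp add: finite_volume_forms_def)
qed

end
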